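(* For every partition $\lambda$, Reutenauer's symmetric function $q_\lambda\in\mathsf{Sym}$ has saturated Newton polytope.
   Context: $\mathsf{Sym}$ is the ring of symmetric functions in $x_1,x_2,\ldots$. Reutenauer's functions $q_{(n)}\in\mathsf{Sym}$, $n\geq1$, are defined recursively by the identity $\sum_{\lambda\vdash n}q_\lambda=s_{(n)}$ (the complete homogeneous symmetric function $h_n$) for every $n\geq 1$, where for a partition $\lambda=(\lambda_1,\lambda_2,\ldots)$ one sets $q_\lambda=q_{(\lambda_1)}q_{(\lambda_2)}\cdots$; thus $q_{(n)}=s_{(n)}-\sum_{\lambda\vdash n,\lambda\neq(n)}q_\lambda$. A polynomial $g=\sum c_\alpha x^\alpha$ has saturated Newton polytope (SNP) if every lattice point of $\mathrm{conv}\{\alpha:c_\alpha\neq0\}$ is an exponent vector with nonzero coefficient; $f\in\mathsf{Sym}$ is SNP if $f(x_1,\ldots,x_m)$ (setting $x_i=0$ for $i>m$) is SNP for every $m\geq1$. *)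

theory Defs
  imports "HOL-Analysis.Finite_Function_Topology" "HOL-Analysis.Convex"
begin

text \<open>
  A monomial \<open>x\<^sup>\<alpha>\<close> in the variables \<open>x\<^sub>1, x\<^sub>2, \<dots>\<close> is given by its exponent vector
  \<open>\<alpha> :: nat \<Rightarrow>\<^sub>0 nat\<close>, where index \<open>i\<close> belongs to the variable \<open>x\<^bsub>i+1\<^esub>\<close>. A polynomial in finitely
  many of these variables is an element of the convolution ring \<open>(nat \<Rightarrow>\<^sub>0 nat) \<Rightarrow>\<^sub>0 'a\<close>.
\<close>

type_synonym expvec = "nat \<Rightarrow>\<^sub>0 nat"

definition mdeg :: "expvec \<Rightarrow> nat" where
  "mdeg \<alpha> = (\<Sum>i\<in>Poly_Mapping.keys \<alpha>. Poly_Mapping.lookup \<alpha> i)"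

lemma mdeg_superset:
  assumes "finite A" "Poly_Mapping.keys \<alpha> \<subseteq> A"
  shows "mdeg \<alpha> = (\<Sum>i\<in>A. Poly_Mapping.lookup \<alpha> i)"
  unfolding mdeg_def using assms by (intro sum.mono_neutral_left) (auto simp: in_keys_iff)

lemma mdeg_add: "mdeg (\<alpha> + \<beta>) = mdeg \<alpha> + mdeg \<beta>"
proof -
  let ?A = "Poly_Mapping.keys \<alpha> \<union> Poly_Mapping.keys \<beta>"
  have "mdeg (\<alpha> + \<beta>) = (\<Sum>i\<in>?A. Poly_Mapping.lookup (\<alpha> + \<beta>) i)"
    by (intro mdeg_superset keys_add) simp
  also have "\<dots> = (\<Sum>i\<in>?A. Poly_Mapping.lookup \<alpha> i) + (\<Sum>i\<in>?A. Poly_Mapping.lookup \<beta> i)"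
    by (simp add: lookup_add sum.distrib)
  also have "\<dots> = mdeg \<alpha> + mdeg \<beta>"
    by (simp add: mdeg_superset[of ?A])
  finally show ?thesis .
qed

lemma mdeg_eq_0_iff: "mdeg \<alpha> = 0 \<longleftrightarrow> \<alpha> = 0"
  by (auto simp: mdeg_def in_keys_iff intro: poly_mapping_eqI)

lemma lookup_le_mdeg: "Poly_Mapping.lookup \<alpha> i \<le> mdeg \<alpha>"
proof (cases "i \<in> Poly_Mapping.keys \<alpha>")
  case True
  then show ?thesis unfolding mdeg_def by (intro member_le_sum) auto
qed (auto simp: in_keys_iff)

lemma mdeg_map_key:
  assumes "bij \<sigma>"
  shows "mdeg (Poly_Mapping.map_key \<sigma> \<alpha>) = mdeg \<alpha>"
proof -
  have inj: "inj \<sigma>" using assms by (rule bij_is_inj)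
  have "\<sigma> ` (\<sigma> -` Poly_Mapping.keys \<alpha>) = Poly_Mapping.keys \<alpha>"
    using assms by (intro surj_image_vimage_eq bij_is_surj)
  then have "bij_betw \<sigma> (\<sigma> -` Poly_Mapping.keys \<alpha>) (Poly_Mapping.keys \<alpha>)"
    using inj unfolding bij_betw_def by (blast intro: inj_on_subset)
  then show ?thesis
    unfolding mdeg_def keys_map_key[OF inj] map_key.rep_eq[OF inj] o_def
    by (rule sum.reindex_bij_betw)
qed

lemma finite_expvecs:
  assumes "finite A"
  shows "finite {\<alpha>. Poly_Mapping.keys \<alpha> \<subseteq> A \<and> mdeg \<alpha> \<le> d}"
proof -
  let ?F = "{f :: nat \<Rightarrow> nat. \<forall>x. (x \<in> A \<longrightarrow> f x \<in> {..d}) \<and> (x \<notin> A \<longrightarrow> f x = 0)}"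
  have "finite ?F" by (rule finite_set_of_finite_funs) (use assms in auto)
  moreover have "Poly_Mapping.lookup ` {\<alpha>. Poly_Mapping.keys \<alpha> \<subseteq> A \<and> mdeg \<alpha> \<le> d} \<subseteq> ?F"
    by (auto simp: in_keys_iff intro: order_trans[OF lookup_le_mdeg])
  ultimately have "finite (Poly_Mapping.lookup ` {\<alpha>. Poly_Mapping.keys \<alpha> \<subseteq> A \<and> mdeg \<alpha> \<le> d})"
    by (rule rev_finite_subset)
  then show ?thesis
    by (rule finite_imageD) (auto intro!: inj_onI simp: poly_mapping.lookup_inject)
qed

lemma keys_add_nat:
  "Poly_Mapping.keys (\<alpha> + \<beta> :: expvec) = Poly_Mapping.keys \<alpha> \<union> Poly_Mapping.keys \<beta>"
  by (auto simp: in_keys_iff lookup_add)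

lemma finite_decomps: "finite {(\<beta>, \<gamma>). \<beta> + \<gamma> = (\<alpha> :: expvec)}"
proof (rule finite_subset)
  let ?S = "{\<beta>. Poly_Mapping.keys \<beta> \<subseteq> Poly_Mapping.keys \<alpha> \<and> mdeg \<beta> \<le> mdeg \<alpha>}"
  show "{(\<beta>, \<gamma>). \<beta> + \<gamma> = \<alpha>} \<subseteq> ?S \<times> ?S"
    by (auto simp: keys_add_nat mdeg_add)
  show "finite (?S \<times> ?S)"
    by (simp add: finite_expvecs)
qed

text \<open>
  The ring \<open>Sym\<close> of symmetric functions with integer coefficients: formal power series in
  \<open>x\<^sub>1, x\<^sub>2, \<dots>\<close> of bounded degree that are invariant under permutations of the variables.
\<close>

typedef symfun = "{f :: expvec \<Rightarrow> int.
    (\<exists>d. \<forall>\<alpha>. f \<alpha> \<noteq> 0 \<longrightarrow> mdeg \<alpha> \<le> d) \<and>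
    (\<forall>\<sigma> \<alpha>. bij \<sigma> \<longrightarrow> f (Poly_Mapping.map_key \<sigma> \<alpha>) = f \<alpha>)}"
  morphisms sf_coeff Abs_symfun
  by (rule exI[of _ "\<lambda>_. 0"]) auto

setup_lifting type_definition_symfun

lemma sf_coeff_inject': "f = g \<longleftrightarrow> (\<forall>\<alpha>. sf_coeff f \<alpha> = sf_coeff g \<alpha>)"
  by (simp add: sf_coeff_inject[symmetric] fun_eq_iff)

instantiation symfun :: comm_ring_1
begin

lift_definition zero_symfun :: symfun is "\<lambda>_. 0"
  by auto

lift_definition one_symfun :: symfun is "\<lambda>\<alpha>. if \<alpha> = 0 then 1 else 0"
  by (auto simp: mdeg_map_key mdeg_eq_0_iff[symmetric])

lift_definition plus_symfun :: "symfun \<Rightarrow> symfun \<Rightarrow> symfun" is "\<lambda>f g \<alpha>. f \<alpha> + g \<alpha>"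
proof safe
  fix f g :: "expvec \<Rightarrow> int" and d e
  assume "\<forall>\<alpha>. f \<alpha> \<noteq> 0 \<longrightarrow> mdeg \<alpha> \<le> d" "\<forall>\<alpha>. g \<alpha> \<noteq> 0 \<longrightarrow> mdeg \<alpha> \<le> e"
  then have "\<forall>\<alpha>. f \<alpha> + g \<alpha> \<noteq> 0 \<longrightarrow> mdeg \<alpha> \<le> max d e"
    by (metis add_0 max.coboundedI1 max.coboundedI2)
  then show "\<exists>d. \<forall>\<alpha>. f \<alpha> + g \<alpha> \<noteq> 0 \<longrightarrow> mdeg \<alpha> \<le> d" ..
qed auto

lift_definition uminus_symfun :: "symfun \<Rightarrow> symfun" is "\<lambda>f \<alpha>. - f \<alpha>"
  by auto

definition minus_symfun :: "symfun \<Rightarrow> symfun \<Rightarrow> symfun" where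
  "minus_symfun f g = f + - g"

lift_definition times_symfun :: "symfun \<Rightarrow> symfun \<Rightarrow> symfun"
  is "\<lambda>f g \<alpha>. \<Sum>(\<beta>, \<gamma>)\<in>{(\<beta>, \<gamma>). \<beta> + \<gamma> = \<alpha>}. f \<beta> * g \<gamma>"
proof safe
  fix f g :: "expvec \<Rightarrow> int" and d e
  assume *: "\<forall>\<alpha>. f \<alpha> \<noteq> 0 \<longrightarrow> mdeg \<alpha> \<le> d" "\<forall>\<alpha>. g \<alpha> \<noteq> 0 \<longrightarrow> mdeg \<alpha> \<le> e"
  have "mdeg \<alpha> \<le> d + e" if "(\<Sum>(\<beta>, \<gamma>)\<in>{(\<beta>, \<gamma>). \<beta> + \<gamma> = \<alpha>}. f \<beta> * g \<gamma>) \<noteq> 0" for \<alpha>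
  proof -
    have "\<exists>p\<in>{(\<beta>, \<gamma>). \<beta> + \<gamma> = \<alpha>}. (case p of (\<beta>, \<gamma>) \<Rightarrow> f \<beta> * g \<gamma>) \<noteq> 0"
      using that by (meson sum.neutral)
    then obtain \<beta> \<gamma> where "\<beta> + \<gamma> = \<alpha>" "f \<beta> * g \<gamma> \<noteq> 0"
      by auto
    then show ?thesis using * by (auto simp: mdeg_add intro!: add_mono)
  qed
  then show "\<exists>d. \<forall>\<alpha>. (\<Sum>(\<beta>, \<gamma>)\<in>{(\<beta>, \<gamma>). \<beta> + \<gamma> = \<alpha>}. f \<beta> * g \<gamma>) \<noteq> 0 \<longrightarrow> mdeg \<alpha> \<le> d"
    by blast
next
  fix f g :: "expvec \<Rightarrow> int" and \<sigma> :: "nat \<Rightarrow> nat" and \<alpha>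
  assume f: "\<forall>\<sigma> \<alpha>. bij \<sigma> \<longrightarrow> f (Poly_Mapping.map_key \<sigma> \<alpha>) = f \<alpha>"
    and g: "\<forall>\<sigma> \<alpha>. bij \<sigma> \<longrightarrow> g (Poly_Mapping.map_key \<sigma> \<alpha>) = g \<alpha>"
    and \<sigma>: "bij \<sigma>"
  let ?m = Poly_Mapping.map_key
  have inj: "inj \<sigma>" "inj (inv \<sigma>)" and bij': "bij (inv \<sigma>)"
    using \<sigma> by (auto simp: bij_is_inj bij_imp_bij_inv)
  have inv1: "?m \<sigma> (?m (inv \<sigma>) p) = p" and inv2: "?m (inv \<sigma>) (?m \<sigma> p) = p" for p :: expvec
    using \<sigma> by (auto intro!: poly_mapping_eqI
        simp: map_key.rep_eq[OF inj(1)] map_key.rep_eq[OF inj(2)] bij_is_inj bij_is_surj surj_f_inv_f)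
  show "(\<Sum>(\<beta>, \<gamma>)\<in>{(\<beta>, \<gamma>). \<beta> + \<gamma> = ?m \<sigma> \<alpha>}. f \<beta> * g \<gamma>) =
        (\<Sum>(\<beta>, \<gamma>)\<in>{(\<beta>, \<gamma>). \<beta> + \<gamma> = \<alpha>}. f \<beta> * g \<gamma>)"
    by (rule sum.reindex_bij_witness[of _ "\<lambda>(\<beta>, \<gamma>). (?m \<sigma> \<beta>, ?m \<sigma> \<gamma>)"
          "\<lambda>(\<beta>, \<gamma>). (?m (inv \<sigma>) \<beta>, ?m (inv \<sigma>) \<gamma>)"])
      (auto simp: inv1 inv2 f g \<sigma> bij' map_key_plus[OF inj(1), symmetric]
        map_key_plus[OF inj(2), symmetric])
qed

instance
proof
  fix a b c :: symfun
  show "a * b * c = a * (b * c)"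
  proof (unfold sf_coeff_inject', rule allI)
    fix \<alpha>
    let ?D = "\<lambda>\<alpha>. {(\<beta>, \<gamma>). \<beta> + \<gamma> = (\<alpha> :: expvec)}"
    have "sf_coeff (a * b * c) \<alpha> =
        (\<Sum>p\<in>?D \<alpha>. \<Sum>q\<in>?D (fst p). sf_coeff a (fst q) * sf_coeff b (snd q) * sf_coeff c (snd p))"
      by (simp add: times_symfun.rep_eq sum_distrib_right case_prod_beta)
    also have "\<dots> = (\<Sum>(p, q)\<in>Sigma (?D \<alpha>) (\<lambda>p. ?D (fst p)).
        sf_coeff a (fst q) * sf_coeff b (snd q) * sf_coeff c (snd p))"
      by (rule sum.Sigma) (auto simp: finite_decomps)
    also have "\<dots> = (\<Sum>(p, q)\<in>Sigma (?D \<alpha>) (\<lambda>p. ?D (snd p)).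
        sf_coeff a (fst p) * (sf_coeff b (fst q) * sf_coeff c (snd q)))"
      by (rule sum.reindex_bij_witness[of _
            "\<lambda>(p, q). ((fst p + fst q, snd q), (fst p, fst q))"
            "\<lambda>(p, q). ((fst q, snd q + snd p), (snd q, snd p))"])
        (auto simp: ac_simps)
    also have "\<dots> = (\<Sum>p\<in>?D \<alpha>. \<Sum>q\<in>?D (snd p).
        sf_coeff a (fst p) * (sf_coeff b (fst q) * sf_coeff c (snd q)))"
      by (rule sum.Sigma[symmetric]) (auto simp: finite_decomps)
    also have "\<dots> = sf_coeff (a * (b * c)) \<alpha>"
      by (simp add: times_symfun.rep_eq sum_distrib_left case_prod_beta)
    finally show "sf_coeff (a * b * c) \<alpha> = sf_coeff (a * (b * c)) \<alpha>" .
  qed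
  show "a * b = b * a"
    unfolding sf_coeff_inject' times_symfun.rep_eq
    by (intro allI sum.reindex_bij_witness[of _ prod.swap prod.swap]) (auto simp: ac_simps)
  show "1 * a = a"
  proof (unfold sf_coeff_inject', rule allI)
    fix \<alpha>
    have "sf_coeff (1 * a) \<alpha> = (\<Sum>p\<in>{(0, \<alpha>)}. sf_coeff 1 (fst p) * sf_coeff a (snd p))"
      unfolding times_symfun.rep_eq case_prod_beta
      by (rule sum.mono_neutral_right) (use finite_decomps[of \<alpha>] in \<open>auto simp: case_prod_unfold one_symfun.rep_eq split: if_splits\<close>)
    then show "sf_coeff (1 * a) \<alpha> = sf_coeff a \<alpha>"
      by (simp add: one_symfun.rep_eq)
  qed
  show "(a + b) * c = a * c + b * c"
    by (simp add: sf_coeff_inject' times_symfun.rep_eq plus_symfun.rep_eq case_prod_beta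
        distrib_right sum.distrib)
  show "a + b + c = a + (b + c)" "a + b = b + a" "0 + a = a" "- a + a = 0"
    by (simp_all add: sf_coeff_inject' plus_symfun.rep_eq zero_symfun.rep_eq uminus_symfun.rep_eq)
  show "a - b = a + - b"
    by (simp add: minus_symfun_def)
  show "(0 :: symfun) \<noteq> 1"
    by (auto simp: sf_coeff_inject' zero_symfun.rep_eq one_symfun.rep_eq)
qed

end

text \<open>The complete homogeneous symmetric function \<open>h\<^sub>n = s\<^bsub>(n)\<^esub>\<close>, the sum of all monomials of degree \<open>n\<close>.\<close>

lift_definition sf_h :: "nat \<Rightarrow> symfun" is "\<lambda>n \<alpha>. if mdeg \<alpha> = n then 1 else 0"
  by (auto simp: mdeg_map_key)

definition is_partition :: "nat list \<Rightarrow> bool" where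
  "is_partition \<mu> \<longleftrightarrow> sorted_wrt (\<ge>) \<mu> \<and> 0 \<notin> set \<mu>"

definition partitions_of :: "nat \<Rightarrow> nat list set" where
  "partitions_of n = {\<mu>. is_partition \<mu> \<and> sum_list \<mu> = n}"

lemma length_le_sum_list: "0 \<notin> set xs \<Longrightarrow> length xs \<le> sum_list (xs :: nat list)"
  by (induction xs) auto

lemma finite_partitions_of: "finite (partitions_of n)"
proof (rule finite_subset)
  show "partitions_of n \<subseteq> {xs. set xs \<subseteq> {..n} \<and> length xs \<le> n}"
    by (auto simp: partitions_of_def is_partition_def intro: length_le_sum_list member_le_sum_list)
  show "finite {xs. set xs \<subseteq> {..n} \<and> length xs \<le> n}"
    by (rule finite_lists_length_le) simp
qed

lemma part_less:
  assumes "\<mu> \<in> partitions_of n - {[n]}" "i \<in> set \<mu>"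
  shows "i < n"
proof (rule ccontr)
  assume "\<not> i < n"
  obtain xs ys where xs: "\<mu> = xs @ i # ys" using assms(2) by (meson split_list)
  then have "sum_list xs + i + sum_list ys = n" "0 \<notin> set xs" "0 \<notin> set ys"
    using assms(1) by (auto simp: partitions_of_def is_partition_def)
  moreover from this have "i = n" "length xs = 0" "length ys = 0"
    using \<open>\<not> i < n\<close> length_le_sum_list[of xs] length_le_sum_list[of ys] by linarith+
  ultimately show False using xs assms(1) by simp
qed

text \<open>
  \<open>reutenauer_q_row n\<close> is \<open>q\<^bsub>(n)\<^esub>\<close>. Only the values at \<open>n \<ge> 1\<close> are meaningful; the value at \<open>0\<close> never
  enters the recursion or the definition of \<open>q\<^sub>\<lambda>\<close>, since partitions have positive parts.
\<close>

function reutenauer_q_row :: "nat \<Rightarrow> symfun" where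
  "reutenauer_q_row n =
     sf_h n - (\<Sum>\<mu>\<in>partitions_of n - {[n]}. prod_list (map reutenauer_q_row \<mu>))"
  by auto
termination
proof (relation "measure id")
  show "(i, n) \<in> measure id" if "\<mu> \<in> partitions_of n - {[n]}" "i \<in> set \<mu>" for n \<mu> i
    using part_less[OF that] by simp
qed simp

declare reutenauer_q_row.simps [simp del]

definition reutenauer_q :: "nat list \<Rightarrow> symfun" where
  "reutenauer_q \<mu> = prod_list (map reutenauer_q_row \<mu>)"

text \<open>The recursion solves the defining identity of Reutenauer's functions.\<close>

lemma sum_reutenauer_q:
  assumes "n \<ge> 1"
  shows "(\<Sum>\<mu>\<in>partitions_of n. reutenauer_q \<mu>) = sf_h n"
proof -
  have "[n] \<in> partitions_of n"
    using assms by (simp add: partitions_of_def is_partition_def)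
  then have "(\<Sum>\<mu>\<in>partitions_of n. reutenauer_q \<mu>) =
      reutenauer_q [n] + (\<Sum>\<mu>\<in>partitions_of n - {[n]}. reutenauer_q \<mu>)"
    by (intro sum.remove finite_partitions_of)
  then show ?thesis
    by (simp add: reutenauer_q_def reutenauer_q_row.simps[of n])
qed

text \<open>
  \<open>sf_restrict m f\<close> is the polynomial \<open>f(x\<^sub>1, \<dots>, x\<^sub>m)\<close>, obtained by setting \<open>x\<^sub>i = 0\<close> for \<open>i > m\<close>: exactly
  the monomials in \<open>x\<^sub>1, \<dots>, x\<^sub>m\<close> survive.
\<close>

lift_definition sf_restrict :: "nat \<Rightarrow> symfun \<Rightarrow> (expvec \<Rightarrow>\<^sub>0 int)"
  is "\<lambda>m f \<alpha>. if Poly_Mapping.keys \<alpha> \<subseteq> {..<m} then f \<alpha> else 0"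
proof -
  fix m :: nat and f :: "expvec \<Rightarrow> int"
  assume "(\<exists>d. \<forall>\<alpha>. f \<alpha> \<noteq> 0 \<longrightarrow> mdeg \<alpha> \<le> d) \<and>
    (\<forall>\<sigma> \<alpha>. bij \<sigma> \<longrightarrow> f (Poly_Mapping.map_key \<sigma> \<alpha>) = f \<alpha>)"
  then obtain d where "\<forall>\<alpha>. f \<alpha> \<noteq> 0 \<longrightarrow> mdeg \<alpha> \<le> d" by blast
  then show "finite {\<alpha>. (if Poly_Mapping.keys \<alpha> \<subseteq> {..<m} then f \<alpha> else 0) \<noteq> 0}"
    by (intro finite_subset[OF _ finite_expvecs[of "{..<m}" d]]) auto
qed

text \<open>
  Exponent vectors are viewed as points of the real vector space \<open>nat \<Rightarrow>\<^sub>0 real\<close>, the union of the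
  spaces \<open>\<real>\<^sup>m\<close> (vectors supported on \<open>{..<m}\<close>); the convex hull of a subset of \<open>\<real>\<^sup>m\<close> lies in \<open>\<real>\<^sup>m\<close>.
\<close>

definition real_expvec :: "expvec \<Rightarrow> (nat \<Rightarrow>\<^sub>0 real)" where
  "real_expvec \<alpha> = Poly_Mapping.map real \<alpha>"

lemma lookup_real_expvec: "Poly_Mapping.lookup (real_expvec \<alpha>) i = real (Poly_Mapping.lookup \<alpha> i)"
  by (simp add: real_expvec_def map.rep_eq when_def)

definition newton_polytope :: "(expvec \<Rightarrow>\<^sub>0 'a::zero) \<Rightarrow> (nat \<Rightarrow>\<^sub>0 real) set" where
  "newton_polytope g = convex hull (real_expvec ` Poly_Mapping.keys g)"

definition SNP :: "(expvec \<Rightarrow>\<^sub>0 'a::zero) \<Rightarrow> bool" where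
  "SNP g \<longleftrightarrow> (\<forall>v\<in>newton_polytope g. (\<forall>i. Poly_Mapping.lookup v i \<in> \<int>) \<longrightarrow>
     (\<exists>\<alpha>. v = real_expvec \<alpha> \<and> Poly_Mapping.lookup g \<alpha> \<noteq> 0))"

definition sf_SNP :: "symfun \<Rightarrow> bool" where
  "sf_SNP f \<longleftrightarrow> (\<forall>m\<ge>1. SNP (sf_restrict m f))"

end

theory Submission
  imports Defs
begin

text \<open>
  Write \<open>f n k\<close> for the sum of the \<open>q\<^sub>\<lambda>\<close> over the partitions \<open>\<lambda>\<close> of \<open>n\<close> whose parts are at least \<open>k\<close>.
  Splitting off one part \<open>k\<close> gives \<open>f n k = f n (k+1) + q\<^bsub>(k)\<^esub> f (n-k) k\<close>. As \<open>f n 2 = h\<^sub>n - h\<^sub>1 h\<^bsub>n-1\<^esub>\<close>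
  has nonpositive coefficients and \<open>q\<^bsub>(k)\<^esub> f (n-k) k\<close> is then a product of two nonpositive factors,
  \<open>-f n k\<close> stays nonnegative for all \<open>2 \<le> k \<le> n\<close>, and \<open>f n n = q\<^bsub>(n)\<^esub>\<close>. So for \<open>n \<ge> 2\<close> the monomials
  of \<open>-q\<^bsub>(n)\<^esub>\<close> are exactly those of degree \<open>n\<close> other than the pure powers. No cancellation occurs in
  \<open>\<plusminus>q\<^sub>\<lambda>\<close>; its support consists of the \<open>\<alpha>\<close> of degree \<open>|\<lambda>|\<close> with all \<open>\<alpha>\<^sub>i \<le> |\<lambda>| - p\<close>, where \<open>p\<close> is the
  number of parts \<open>\<ge> 2\<close>. These are linear inequalities, so the support contains all lattice points
  of its convex hull.
\<close>

section \<open>Exponent vectors with bounded entries\<close>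

text \<open>The cap \<open>N - p\<close> is written additively, so that the set is empty for
  \<open>p > N\<close> instead of being distorted by truncated subtraction.\<close>

definition capped :: "nat \<Rightarrow> nat \<Rightarrow> expvec set" where
  "capped N p = {\<alpha>. mdeg \<alpha> = N \<and> (\<forall>i. Poly_Mapping.lookup \<alpha> i + p \<le> N)}"

lemma capped_add:
  assumes "\<beta> \<in> capped N p" "\<gamma> \<in> capped M q"
  shows "\<beta> + \<gamma> \<in> capped (N + M) (p + q)"
  unfolding capped_def
proof safe
  fix i
  show "Poly_Mapping.lookup (\<beta> + \<gamma>) i + (p + q) \<le> N + M"
    using assms add_le_mono[of "Poly_Mapping.lookup \<beta> i + p" N "Poly_Mapping.lookup \<gamma> i + q" M]
    by (simp add: capped_def lookup_add)
qed (use assms in \<open>auto simp: capped_def mdeg_add\<close>)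

lemma capped_antimono: "q \<le> p \<Longrightarrow> capped N p \<subseteq> capped N q"
  by (auto simp: capped_def) (meson add_left_mono order_trans)

lemma mdeg_zero: "mdeg 0 = 0"
  by (simp add: mdeg_eq_0_iff)

lemma mdeg_single: "mdeg (Poly_Mapping.single i n) = n"
  by (simp add: mdeg_def)

lemma sum_lookup_le_mdeg:
  assumes "finite A"
  shows "(\<Sum>i\<in>A. Poly_Mapping.lookup \<alpha> i) \<le> mdeg \<alpha>"
proof -
  have "(\<Sum>i\<in>A. Poly_Mapping.lookup \<alpha> i) \<le> (\<Sum>i\<in>A \<union> Poly_Mapping.keys \<alpha>. Poly_Mapping.lookup \<alpha> i)"
    by (intro sum_mono2) (use assms in auto)
  also have "\<dots> = mdeg \<alpha>"
    using assms by (intro mdeg_superset[symmetric]) auto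
  finally show ?thesis .
qed

section \<open>Greedy removal of units from a bounded vector\<close>

lemma diff_single_add:
  assumes "Poly_Mapping.lookup \<alpha> i > 0"
  shows "\<alpha> = Poly_Mapping.single i 1 + (\<alpha> - Poly_Mapping.single i (1 :: nat))"
  using assms by (intro poly_mapping_eqI) (auto simp: lookup_add lookup_minus lookup_single when_def)

text \<open>The set \<open>A\<close> may be infinite: the maximum is taken over its finite
  intersection with the support, as all other entries are 0. Taking \<open>A = UNIV\<close> gives a
  largest entry, and \<open>A = - {i}\<close> a second largest one.\<close>

lemma ex_max_lookup:
  assumes "A \<inter> Poly_Mapping.keys \<alpha> \<noteq> {}"
  obtains i where "i \<in> A" "Poly_Mapping.lookup \<alpha> i > 0"
    "\<And>j. j \<in> A \<Longrightarrow> Poly_Mapping.lookup \<alpha> j \<le> Poly_Mapping.lookup (\<alpha> :: expvec) i"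
proof -
  let ?K = "A \<inter> Poly_Mapping.keys \<alpha>"
  have fin: "finite (Poly_Mapping.lookup \<alpha> ` ?K)" by simp
  have "Max (Poly_Mapping.lookup \<alpha> ` ?K) \<in> Poly_Mapping.lookup \<alpha> ` ?K"
    using fin assms by (intro Max_in) auto
  then obtain i where i: "i \<in> ?K" "Max (Poly_Mapping.lookup \<alpha> ` ?K) = Poly_Mapping.lookup \<alpha> i"
    by auto
  have "Poly_Mapping.lookup \<alpha> j \<le> Poly_Mapping.lookup \<alpha> i" if "j \<in> A" for j
  proof (cases "j \<in> Poly_Mapping.keys \<alpha>")
    case True
    then show ?thesis using Max_ge[OF fin, of "Poly_Mapping.lookup \<alpha> j"] i that by auto
  qed (auto simp: in_keys_iff)
  with i that[of i] show thesis by (auto simp: in_keys_iff)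
qed

text \<open>The unit is taken from a largest entry, which thereby meets the new cap. Any other entry
  is at most half of \<open>N + 1\<close>, and \<open>2 * p \<le> N\<close> puts this, rounded down,
  below \<open>N - p\<close>.\<close>

lemma capped_remove_unit:
  assumes \<alpha>: "\<alpha> \<in> capped (Suc N) p" and p: "2 * p \<le> N"
  obtains i \<alpha>' where "\<alpha> = Poly_Mapping.single i 1 + \<alpha>'" "\<alpha>' \<in> capped N p"
proof -
  have deg: "mdeg \<alpha> = Suc N" and cap: "\<And>i. Poly_Mapping.lookup \<alpha> i + p \<le> Suc N"
    using \<alpha> by (auto simp: capped_def)
  have "\<alpha> \<noteq> 0" using deg by (auto simp: mdeg_zero)
  then have "UNIV \<inter> Poly_Mapping.keys \<alpha> \<noteq> {}" by simp
  then obtain i where i: "Poly_Mapping.lookup \<alpha> i > 0"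
    "\<And>j. Poly_Mapping.lookup \<alpha> j \<le> Poly_Mapping.lookup \<alpha> i"
    by (rule ex_max_lookup) auto
  let ?\<beta> = "\<alpha> - Poly_Mapping.single i 1"
  have eq: "\<alpha> = Poly_Mapping.single i 1 + ?\<beta>"
    using i(1) by (rule diff_single_add)
  from arg_cong[OF this, of mdeg] have "mdeg ?\<beta> = N"
    by (simp add: deg mdeg_add mdeg_single)
  moreover have "Poly_Mapping.lookup ?\<beta> j + p \<le> N" for j
  proof (cases "j = i")
    case True
    then show ?thesis using cap[of i] i(1) by (simp add: lookup_minus)
  next
    case False
    have "(\<Sum>k\<in>{i, j}. Poly_Mapping.lookup \<alpha> k) \<le> Suc N"
      using sum_lookup_le_mdeg[of "{i, j}" \<alpha>] deg by simp
    then have "Poly_Mapping.lookup \<alpha> i + Poly_Mapping.lookup \<alpha> j \<le> Suc N"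
      using False by simp
    then show ?thesis using i(2)[of j] p False
      by (simp add: lookup_minus lookup_single)
  qed
  ultimately have "?\<beta> \<in> capped N p" by (auto simp: capped_def)
  with eq that show thesis by blast
qed

text \<open>Units are removed one at a time; \<open>2 * p \<le> N\<close> at the final degree
  implies the same bound at every intermediate degree.\<close>

lemma capped_remove_many:
  assumes "\<alpha> \<in> capped (N + n) p" "2 * p \<le> N"
  shows "\<exists>\<gamma> \<alpha>'. \<alpha> = \<gamma> + \<alpha>' \<and> mdeg \<gamma> = n \<and> \<alpha>' \<in> capped N p"
  using assms(1)
proof (induction n arbitrary: \<alpha>)
  case 0
  then show ?case by (intro exI[of _ 0] exI[of _ \<alpha>]) (simp add: mdeg_zero)
next
  case (Suc n)
  obtain i \<alpha>1 where 1: "\<alpha> = Poly_Mapping.single i 1 + \<alpha>1" "\<alpha>1 \<in> capped (N + n) p"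
    using capped_remove_unit[of \<alpha> "N + n" p] Suc.prems assms(2) by auto
  from Suc.IH[OF 1(2)] obtain \<gamma> \<alpha>' where "\<alpha>1 = \<gamma> + \<alpha>'" "mdeg \<gamma> = n" "\<alpha>' \<in> capped N p"
    by blast
  with 1(1) show ?case
    by (intro exI[of _ "Poly_Mapping.single i 1 + \<gamma>"] exI[of _ \<alpha>'])
      (simp add: mdeg_add mdeg_single add.assoc)
qed

text \<open>One unit is taken from each of two largest entries. The degree falls by two but the cap
  only by one, which these two entries satisfy; every other entry is at most a third of
  \<open>N + 2\<close>, hence at most \<open>N - p\<close>.\<close>

lemma capped_remove_pair:
  assumes \<alpha>: "\<alpha> \<in> capped (Suc (Suc N)) (Suc p)" and p: "2 * p \<le> N"
  obtains i j \<alpha>' where "i \<noteq> j"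
    "\<alpha> = Poly_Mapping.single i 1 + Poly_Mapping.single j 1 + \<alpha>'" "\<alpha>' \<in> capped N p"
proof -
  have deg: "mdeg \<alpha> = Suc (Suc N)" and cap: "\<And>i. Poly_Mapping.lookup \<alpha> i + p \<le> Suc N"
    using \<alpha> by (auto simp: capped_def)
  have "\<alpha> \<noteq> 0" using deg by (auto simp: mdeg_zero)
  then have "UNIV \<inter> Poly_Mapping.keys \<alpha> \<noteq> {}" by simp
  then obtain i where i: "Poly_Mapping.lookup \<alpha> i > 0"
    "\<And>k. Poly_Mapping.lookup \<alpha> k \<le> Poly_Mapping.lookup \<alpha> i"
    by (rule ex_max_lookup) auto
  \<comment> \<open>A second positive entry exists, because the cap \<open>N + 1 - p\<close> is
    smaller than the degree \<open>N + 2\<close>.\<close>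
  have "(- {i}) \<inter> Poly_Mapping.keys \<alpha> \<noteq> {}"
  proof
    assume "(- {i}) \<inter> Poly_Mapping.keys \<alpha> = {}"
    then have "mdeg \<alpha> = (\<Sum>k\<in>{i}. Poly_Mapping.lookup \<alpha> k)"
      by (intro mdeg_superset) auto
    then show False using deg cap[of i] by simp
  qed
  then obtain j where j: "j \<noteq> i" "Poly_Mapping.lookup \<alpha> j > 0"
    "\<And>k. k \<noteq> i \<Longrightarrow> Poly_Mapping.lookup \<alpha> k \<le> Poly_Mapping.lookup \<alpha> j"
    by (rule ex_max_lookup) auto
  define \<beta> where "\<beta> = \<alpha> - Poly_Mapping.single i 1 - Poly_Mapping.single j 1"
  have eq: "\<alpha> = Poly_Mapping.single i 1 + Poly_Mapping.single j 1 + \<beta>"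
    using i(1) j(1,2)
    by (intro poly_mapping_eqI) (auto simp: \<beta>_def lookup_add lookup_minus lookup_single when_def)
  from arg_cong[OF this, of mdeg] have "mdeg \<beta> = N"
    by (simp add: deg mdeg_add mdeg_single)
  moreover have "Poly_Mapping.lookup \<beta> k + p \<le> N" for k
  proof (cases "k = i \<or> k = j")
    case True
    then show ?thesis using cap[of k] i(1) j(1,2)
      by (auto simp: \<beta>_def lookup_minus lookup_single)
  next
    case False
    have "(\<Sum>k\<in>{i, j, k}. Poly_Mapping.lookup \<alpha> k) \<le> Suc (Suc N)"
      using sum_lookup_le_mdeg[of "{i, j, k}" \<alpha>] deg by simp
    then have "Poly_Mapping.lookup \<alpha> i + Poly_Mapping.lookup \<alpha> j + Poly_Mapping.lookup \<alpha> k \<le> Suc (Suc N)"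
      using False j(1) by auto
    then show ?thesis using i(2)[of k] j(3)[of k] p False
      by (simp add: \<beta>_def lookup_minus lookup_single)
  qed
  ultimately have "\<beta> \<in> capped N p" by (auto simp: capped_def)
  with eq j(1) show thesis by (intro that[of i j \<beta>]) auto
qed

text \<open>Two units at distinct positions are reserved for \<open>\<beta>\<close>, so that it
  cannot be a pure power however its remaining \<open>n - 2\<close> units are chosen.\<close>

lemma capped_1_split:
  assumes "\<alpha> \<in> capped (n + N) (Suc p)" "2 * p \<le> N" "n \<ge> 2"
  shows "\<exists>\<beta>\<in>capped n 1. \<exists>\<gamma>\<in>capped N p. \<alpha> = \<beta> + \<gamma>"
proof -
  obtain n' where n: "n = Suc (Suc n')"
    using assms(3) le_Suc_ex[of 2 n] by auto
  obtain i j \<alpha>1 where ij: "i \<noteq> j"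
    and 1: "\<alpha> = Poly_Mapping.single i 1 + Poly_Mapping.single j 1 + \<alpha>1" "\<alpha>1 \<in> capped (N + n') p"
    using capped_remove_pair[of \<alpha> "N + n'" p] assms(1,2) by (auto simp: n add.commute)
  from capped_remove_many[OF 1(2) assms(2)] obtain \<gamma> \<alpha>'
    where 2: "\<alpha>1 = \<gamma> + \<alpha>'" "mdeg \<gamma> = n'" "\<alpha>' \<in> capped N p"
    by blast
  define \<beta> where "\<beta> = Poly_Mapping.single i 1 + Poly_Mapping.single j 1 + \<gamma>"
  have "Poly_Mapping.lookup \<beta> k + 1 \<le> n" for k
    using lookup_le_mdeg[of \<gamma> k] 2(2) ij
    by (auto simp: \<beta>_def n lookup_add lookup_single when_def)
  then have "\<beta> \<in> capped n 1"
    by (simp add: capped_def) (simp add: \<beta>_def mdeg_add mdeg_single 2 n)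
  then show ?thesis
    using 1(1) 2(1,3) unfolding \<beta>_def by (metis add.assoc)
qed

lemma capped_0_split:
  assumes "\<alpha> \<in> capped (n + N) p" "2 * p \<le> N"
  shows "\<exists>\<beta>\<in>capped n 0. \<exists>\<gamma>\<in>capped N p. \<alpha> = \<beta> + \<gamma>"
proof -
  obtain \<gamma> \<alpha>' where "\<alpha> = \<gamma> + \<alpha>'" "mdeg \<gamma> = n" "\<alpha>' \<in> capped N p"
    using capped_remove_many[of \<alpha> N n p] assms by (metis add.commute)
  moreover from \<open>mdeg \<gamma> = n\<close> have "\<gamma> \<in> capped n 0"
    using lookup_le_mdeg[of \<gamma>] by (simp add: capped_def)
  ultimately show ?thesis by blast
qed

section \<open>Symmetric functions with nonnegative coefficients\<close>

definition nonneg_with_support :: "symfun \<Rightarrow> expvec set \<Rightarrow> bool" where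
  "nonneg_with_support f A \<longleftrightarrow> (\<forall>\<alpha>. sf_coeff f \<alpha> \<ge> 0 \<and> (sf_coeff f \<alpha> \<noteq> 0 \<longleftrightarrow> \<alpha> \<in> A))"

text \<open>A sum of nonnegative terms vanishes only if every term does, so nothing cancels and the
  support is the full Minkowski sum.\<close>

lemma nonneg_with_support_mult:
  assumes f: "nonneg_with_support f A" and g: "nonneg_with_support g B"
  shows "nonneg_with_support (f * g) {\<alpha>. \<exists>\<beta>\<in>A. \<exists>\<gamma>\<in>B. \<alpha> = \<beta> + \<gamma>}"
  unfolding nonneg_with_support_def
proof (intro allI conjI)
  fix \<alpha>
  have coeff: "sf_coeff (f * g) \<alpha> =
      (\<Sum>p\<in>{(\<beta>, \<gamma>). \<beta> + \<gamma> = \<alpha>}. sf_coeff f (fst p) * sf_coeff g (snd p))"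
    by (simp add: times_symfun.rep_eq case_prod_beta)
  have nn: "sf_coeff f (fst p) * sf_coeff g (snd p) \<ge> 0" for p
    using f g by (simp add: nonneg_with_support_def)
  show "sf_coeff (f * g) \<alpha> \<ge> 0"
    unfolding coeff using nn by (intro sum_nonneg)
  have "sf_coeff (f * g) \<alpha> = 0 \<longleftrightarrow>
      (\<forall>p\<in>{(\<beta>, \<gamma>). \<beta> + \<gamma> = \<alpha>}. sf_coeff f (fst p) * sf_coeff g (snd p) = 0)"
    unfolding coeff using nn by (intro sum_nonneg_eq_0_iff finite_decomps)
  then show "(sf_coeff (f * g) \<alpha> \<noteq> 0) = (\<alpha> \<in> {\<alpha>. \<exists>\<beta>\<in>A. \<exists>\<gamma>\<in>B. \<alpha> = \<beta> + \<gamma>})"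
    using f g by (auto simp: nonneg_with_support_def)
qed

lemma nonneg_with_support_add:
  assumes "nonneg_with_support f A" "nonneg_with_support g B"
  shows "nonneg_with_support (f + g) (A \<union> B)"
  using assms by (auto simp: nonneg_with_support_def plus_symfun.rep_eq add_nonneg_eq_0_iff)

section \<open>The coefficients of \<open>sf_h 1 * sf_h (n - 1) - sf_h n\<close>\<close>

lemma coeff_h1_times_h:
  assumes "n \<ge> 1"
  shows "sf_coeff (sf_h 1 * sf_h (n - 1)) \<alpha> = (if mdeg \<alpha> = n then int (card (Poly_Mapping.keys \<alpha>)) else 0)"
proof -
  let ?D = "{(\<beta>, \<gamma>). \<beta> + \<gamma> = \<alpha>}"
  let ?E = "{p \<in> ?D. mdeg (fst p) = 1 \<and> mdeg (snd p) = n - 1}"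
  have "sf_coeff (sf_h 1 * sf_h (n - 1)) \<alpha> =
      (\<Sum>p\<in>?D. if mdeg (fst p) = 1 \<and> mdeg (snd p) = n - 1 then 1 else 0)"
    by (auto simp: times_symfun.rep_eq sf_h.rep_eq case_prod_beta intro!: sum.cong)
  also have "\<dots> = int (card ?E)"
    using finite_decomps by (simp add: sum.If_cases Int_def)
  also have "card ?E = (if mdeg \<alpha> = n then card (Poly_Mapping.keys \<alpha>) else 0)"
  proof (cases "mdeg \<alpha> = n")
    case False
    then have "?E = {}" using assms by (auto simp: mdeg_add)
    then have "card ?E = 0" by (simp only: card.empty)
    then show ?thesis using False by (simp only: if_False)
  next
    case True
    \<comment> \<open>Splitting off a factor of degree 1 amounts to choosing a variable that occurs
      in the monomial.\<close>
    let ?\<phi> = "\<lambda>i. (Poly_Mapping.single i (1 :: nat), \<alpha> - Poly_Mapping.single i 1)"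
    have "bij_betw ?\<phi> (Poly_Mapping.keys \<alpha>) ?E"
    proof (rule bij_betw_imageI)
      show "inj_on ?\<phi> (Poly_Mapping.keys \<alpha>)"
        by (rule inj_onI) (metis Pair_inject lookup_single_eq lookup_single_not_eq zero_neq_one)
      show "?\<phi> ` Poly_Mapping.keys \<alpha> = ?E"
      proof (intro equalityI subsetI)
        fix p assume "p \<in> ?\<phi> ` Poly_Mapping.keys \<alpha>"
        then obtain i where i: "i \<in> Poly_Mapping.keys \<alpha>" "p = ?\<phi> i" by blast
        have eq: "\<alpha> = Poly_Mapping.single i 1 + (\<alpha> - Poly_Mapping.single i 1)"
          using i(1) by (intro diff_single_add) (simp add: in_keys_iff)
        from arg_cong[OF this, of mdeg] have "mdeg (\<alpha> - Poly_Mapping.single i 1) = n - 1"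
          by (simp add: True mdeg_add mdeg_single)
        with i(2) eq show "p \<in> ?E" by (simp add: mdeg_single)
      next
        fix p assume p: "p \<in> ?E"
        then have "mdeg (fst p) = 1" by simp
        then obtain i where i: "Poly_Mapping.lookup (fst p) i > 0"
          by (metis gr0I mdeg_zero poly_mapping_eqI lookup_zero zero_neq_one)
        have eq: "fst p = Poly_Mapping.single i 1 + (fst p - Poly_Mapping.single i 1)"
          using i by (rule diff_single_add)
        from arg_cong[OF this, of mdeg] p have "mdeg (fst p - Poly_Mapping.single i 1) = 0"
          by (simp add: mdeg_add mdeg_single)
        with eq have fst: "fst p = Poly_Mapping.single i 1"
          by (simp add: mdeg_eq_0_iff)
        have sum: "\<alpha> = fst p + snd p" using p by auto
        then have "i \<in> Poly_Mapping.keys \<alpha>" by (simp add: fst keys_add_nat)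
        moreover have "p = ?\<phi> i" using sum by (simp add: fst prod_eq_iff)
        ultimately show "p \<in> ?\<phi> ` Poly_Mapping.keys \<alpha>" by blast
      qed
    qed
    then have "card (Poly_Mapping.keys \<alpha>) = card ?E" by (rule bij_betw_same_card)
    then show ?thesis using True by simp
  qed
  finally show ?thesis by simp
qed

text \<open>An entry reaches \<open>n\<close> only by absorbing the whole degree. This translates
  the cap into the number of variables, which is what the coefficients count.\<close>

lemma capped_1_iff_card_keys:
  assumes "mdeg \<alpha> = n" "n \<ge> 1"
  shows "\<alpha> \<in> capped n 1 \<longleftrightarrow> card (Poly_Mapping.keys \<alpha>) \<ge> 2"
proof
  assume *: "\<alpha> \<in> capped n 1"
  show "card (Poly_Mapping.keys \<alpha>) \<ge> 2"
  proof (rule ccontr)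
    assume "\<not> ?thesis"
    then have "card (Poly_Mapping.keys \<alpha>) = 0 \<or> card (Poly_Mapping.keys \<alpha>) = 1" by linarith
    then obtain i where "Poly_Mapping.keys \<alpha> \<subseteq> {i}"
      by (auto simp: card_1_singleton_iff)
    then have "mdeg \<alpha> = Poly_Mapping.lookup \<alpha> i"
      using mdeg_superset[of "{i}" \<alpha>] by simp
    moreover have "Poly_Mapping.lookup \<alpha> i + 1 \<le> n" using * by (simp add: capped_def)
    ultimately show False using assms by simp
  qed
next
  assume *: "card (Poly_Mapping.keys \<alpha>) \<ge> 2"
  have "Poly_Mapping.lookup \<alpha> i + 1 \<le> n" for i
  proof -
    have "\<not> Poly_Mapping.keys \<alpha> \<subseteq> {i}"
      using * card_mono[of "{i}" "Poly_Mapping.keys \<alpha>"] by auto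
    then obtain j where j: "j \<in> Poly_Mapping.keys \<alpha>" "j \<noteq> i" by auto
    then have "Poly_Mapping.lookup \<alpha> i + Poly_Mapping.lookup \<alpha> j \<le> n"
      using sum_lookup_le_mdeg[of "{i, j}" \<alpha>] assms by simp
    then show ?thesis using j by (simp add: in_keys_iff)
  qed
  then show "\<alpha> \<in> capped n 1" using assms by (simp add: capped_def)
qed

text \<open>In degree \<open>n\<close> the coefficient is the number of occurring variables minus
  one; \<open>n \<ge> 1\<close> makes it nonnegative.\<close>

lemma nonneg_with_support_h1_h_diff:
  assumes "n \<ge> 1"
  shows "nonneg_with_support (sf_h 1 * sf_h (n - 1) - sf_h n) (capped n 1)"
  unfolding nonneg_with_support_def
proof
  fix \<alpha>
  have coeff: "sf_coeff (sf_h 1 * sf_h (n - 1) - sf_h n) \<alpha> =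
      (if mdeg \<alpha> = n then int (card (Poly_Mapping.keys \<alpha>)) - 1 else 0)"
    unfolding minus_symfun_def plus_symfun.rep_eq uminus_symfun.rep_eq coeff_h1_times_h[OF assms]
      sf_h.rep_eq by simp
  show "0 \<le> sf_coeff (sf_h 1 * sf_h (n - 1) - sf_h n) \<alpha> \<and>
      (sf_coeff (sf_h 1 * sf_h (n - 1) - sf_h n) \<alpha> \<noteq> 0 \<longleftrightarrow> \<alpha> \<in> capped n 1)"
  proof (cases "mdeg \<alpha> = n")
    case True
    then have "Poly_Mapping.keys \<alpha> \<noteq> {}" using assms by (auto simp: mdeg_def)
    then have "card (Poly_Mapping.keys \<alpha>) \<ge> 1" by (simp add: Suc_le_eq card_gt_0_iff)
    then show ?thesis
      using True capped_1_iff_card_keys[OF True assms] unfolding coeff by auto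
  next
    case False
    then show ?thesis unfolding coeff by (simp add: capped_def)
  qed
qed

section \<open>Reutenauer's functions\<close>

definition partitions_ge :: "nat \<Rightarrow> nat \<Rightarrow> nat list set" where
  "partitions_ge n k = {\<mu> \<in> partitions_of n. \<forall>i\<in>set \<mu>. k \<le> i}"

text \<open>This is \<open>f n k\<close> of the opening remarks; for \<open>n \<ge> 1\<close> it
  leads from \<open>sf_h n\<close> at \<open>k = 1\<close> to \<open>reutenauer_q [n]\<close> at
  \<open>k = n\<close>.\<close>

definition q_tail :: "nat \<Rightarrow> nat \<Rightarrow> symfun" where
  "q_tail n k = (\<Sum>\<mu>\<in>partitions_ge n k. reutenauer_q \<mu>)"

lemma finite_partitions_ge: "finite (partitions_ge n k)"
  by (simp add: partitions_ge_def finite_partitions_of)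

text \<open>Parts are listed in weakly decreasing order, so a smallest possible part
  \<open>k\<close>, if present, stands last; deleting it is a bijection onto
  \<open>partitions_ge (n - k) k\<close>.\<close>

lemma q_tail_rec:
  assumes "1 \<le> k" "k \<le> n"
  shows "q_tail n k = q_tail n (Suc k) + reutenauer_q [k] * q_tail (n - k) k"
proof -
  let ?snoc = "\<lambda>\<mu>. \<mu> @ [k]"
  have split: "partitions_ge n k = partitions_ge n (Suc k) \<union> ?snoc ` partitions_ge (n - k) k"
  proof (intro equalityI subsetI)
    fix \<mu> assume \<mu>: "\<mu> \<in> partitions_ge n k"
    show "\<mu> \<in> partitions_ge n (Suc k) \<union> ?snoc ` partitions_ge (n - k) k"
    proof (cases "k \<in> set \<mu>")
      case False
      then have "\<mu> \<in> partitions_ge n (Suc k)"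
        using \<mu> by (auto simp: partitions_ge_def Suc_le_eq le_less)
      then show ?thesis by blast
    next
      case True
      then obtain \<nu> l where \<nu>: "\<mu> = \<nu> @ [l]"
        by (metis empty_iff list.set(1) rev_exhaust)
      have "l = k"
        using True \<mu> by (auto simp: \<nu> partitions_ge_def partitions_of_def is_partition_def sorted_wrt_append
            intro!: antisym)
      with \<mu> \<nu> have "\<nu> \<in> partitions_ge (n - k) k"
        by (auto simp: partitions_ge_def partitions_of_def is_partition_def sorted_wrt_append)
      with \<nu> \<open>l = k\<close> show ?thesis by blast
    qed
  next
    fix \<mu> assume "\<mu> \<in> partitions_ge n (Suc k) \<union> ?snoc ` partitions_ge (n - k) k"
    then show "\<mu> \<in> partitions_ge n k"
      using assms
      by (auto simp: partitions_ge_def partitions_of_def is_partition_def sorted_wrt_append)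
  qed
  have "partitions_ge n (Suc k) \<inter> ?snoc ` partitions_ge (n - k) k = {}"
    by (auto simp: partitions_ge_def)
  then have "q_tail n k = q_tail n (Suc k) + (\<Sum>\<mu>\<in>?snoc ` partitions_ge (n - k) k. reutenauer_q \<mu>)"
    unfolding q_tail_def split by (intro sum.union_disjoint) (simp_all add: finite_partitions_ge)
  also have "(\<Sum>\<mu>\<in>?snoc ` partitions_ge (n - k) k. reutenauer_q \<mu>) =
      (\<Sum>\<mu>\<in>partitions_ge (n - k) k. reutenauer_q (\<mu> @ [k]))"
    by (subst sum.reindex) (auto simp: inj_on_def)
  also have "\<dots> = reutenauer_q [k] * q_tail (n - k) k"
    by (simp add: q_tail_def reutenauer_q_def sum_distrib_left mult.commute)
  finally show ?thesis .
qed

lemma q_tail_eq_0: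
  assumes "1 \<le> n" "n < k"
  shows "q_tail n k = 0"
proof -
  have "partitions_ge n k = {}"
  proof (intro equals0I)
    fix \<mu> assume \<mu>: "\<mu> \<in> partitions_ge n k"
    then have "\<mu> \<noteq> []" using assms(1) by (auto simp: partitions_ge_def partitions_of_def)
    then obtain i where "i \<in> set \<mu>" by (meson list.set_sel(1))
    then show False using \<mu> assms(2) member_le_sum_list[of i \<mu>]
      by (force simp: partitions_ge_def partitions_of_def)
  qed
  then show ?thesis by (simp add: q_tail_def)
qed

lemma q_tail_0: "q_tail 0 k = 1"
proof -
  have "partitions_ge 0 k = {[]}"
    by (auto simp: partitions_ge_def partitions_of_def is_partition_def)
      (metis length_le_sum_list le_zero_eq length_0_conv sum_list_eq_0_iff)
  then show ?thesis by (simp add: q_tail_def reutenauer_q_def)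
qed

text \<open>In the recursion at \<open>k = n\<close> the first summand vanishes and the cofactor is
  \<open>q_tail 0 n\<close>, which is 1 by the empty partition.\<close>

lemma q_tail_diag: "1 \<le> n \<Longrightarrow> q_tail n n = reutenauer_q [n]"
  by (simp add: q_tail_rec q_tail_eq_0 q_tail_0)

lemma q_tail_1: "q_tail n 1 = sf_h n"
proof (cases "n = 0")
  case True
  have "sf_h 0 = 1"
    by (simp add: sf_coeff_inject' sf_h.rep_eq one_symfun.rep_eq mdeg_eq_0_iff)
  then show ?thesis by (simp add: True q_tail_0)
next
  case False
  have "partitions_ge n 1 = partitions_of n"
    by (auto simp: partitions_ge_def partitions_of_def is_partition_def Suc_le_eq intro!: Nat.gr0I)
  then show ?thesis using False sum_reutenauer_q[of n] by (simp add: q_tail_def)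
qed

lemma reutenauer_q_1: "reutenauer_q [1] = sf_h 1"
  by (metis le_refl q_tail_1 q_tail_diag)

text \<open>The induction on \<open>k\<close> keeps \<open>n\<close> arbitrary, because the
  recursion also calls on degree \<open>n - k\<close> and, through the diagonal, on degree
  \<open>k\<close>.\<close>

lemma nonneg_with_support_q_tail:
  assumes "2 \<le> k" "k \<le> n"
  shows "nonneg_with_support (- q_tail n k) (capped n 1)"
  using assms
proof (induction k arbitrary: n rule: dec_induct)
  case base
  \<comment> \<open>The recursion at \<open>k = 1\<close>, where both tails with
    \<open>k = 1\<close> are complete homogeneous.\<close>
  then have "- q_tail n 2 = sf_h 1 * sf_h (n - 1) - sf_h n"
    using q_tail_rec[of 1 n] by (simp add: q_tail_1[simplified] reutenauer_q_1[simplified] numeral_2_eq_2)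
  then show ?case using nonneg_with_support_h1_h_diff[of n] base by simp
next
  case (step k)
  have rec: "- q_tail n (Suc k) = - q_tail n k + (- reutenauer_q [k]) * (- q_tail (n - k) k)"
    using q_tail_rec[of k n] step by simp
  have n: "nonneg_with_support (- q_tail n k) (capped n 1)"
    using step by simp
  show ?case
  proof (cases "n - k < k")
    case True
    \<comment> \<open>Here \<open>Suc k \<le> n\<close> matters: it gives
      \<open>n - k \<ge> 1\<close> and so excludes \<open>q_tail 0 k = 1\<close>.\<close>
    then have "q_tail (n - k) k = 0" using step.prems by (intro q_tail_eq_0) auto
    then show ?thesis using rec n by simp
  next
    case False
    have "nonneg_with_support (- reutenauer_q [k]) (capped k 1)"
      using step.IH[of k] step.hyps q_tail_diag[of k] by simp
    moreover have "nonneg_with_support (- q_tail (n - k) k) (capped (n - k) 1)"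
      using step.IH[of "n - k"] False by simp
    ultimately have "nonneg_with_support (- q_tail n (Suc k))
        (capped n 1 \<union> {\<alpha>. \<exists>\<beta>\<in>capped k 1. \<exists>\<gamma>\<in>capped (n - k) 1. \<alpha> = \<beta> + \<gamma>})"
      unfolding rec by (intro nonneg_with_support_add nonneg_with_support_mult n)
    \<comment> \<open>The product even satisfies the stricter cap \<open>n - 2\<close>, so it adds
      no new monomials to the support.\<close>
    moreover have "\<beta> + \<gamma> \<in> capped n 1" if "\<beta> \<in> capped k 1" "\<gamma> \<in> capped (n - k) 1" for \<beta> \<gamma>
    proof -
      have "\<beta> + \<gamma> \<in> capped (k + (n - k)) (1 + 1)"
        using that by (rule capped_add)
      then show ?thesis
        using step.prems capped_antimono[of 1 "1 + 1" n] by auto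
    qed
    then have "capped n 1 \<union> {\<alpha>. \<exists>\<beta>\<in>capped k 1. \<exists>\<gamma>\<in>capped (n - k) 1. \<alpha> = \<beta> + \<gamma>} = capped n 1"
      by blast
    ultimately show ?thesis by simp
  qed
qed

text \<open>The sign exponent and the deficit of the cap are the same number, 0 or 1, so that both
  add up alike over the parts of a partition.\<close>

lemma nonneg_with_support_q_row:
  assumes "n \<ge> 1"
  shows "nonneg_with_support ((- 1) ^ (if n = 1 then 0 else 1) * reutenauer_q_row n)
    (capped n (if n = 1 then 0 else 1))"
proof (cases "n = 1")
  case True
  have "reutenauer_q_row n = sf_h 1"
    using reutenauer_q_1 by (simp add: True reutenauer_q_def)
  moreover have "nonneg_with_support (sf_h 1) (capped 1 0)"
    by (auto simp: nonneg_with_support_def sf_h.rep_eq capped_def)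
      (metis lookup_le_mdeg One_nat_def)
  ultimately show ?thesis by (simp add: True)
next
  case False
  then show ?thesis
    using nonneg_with_support_q_tail[of n n] q_tail_diag[of n] assms by (simp add: reutenauer_q_def)
qed

text \<open>The bound \<open>2 * p \<le> sum_list \<mu>\<close> holds because each part other than 1
  is at least 2. It is carried through the induction since the splitting lemmas need it to show that
  the Minkowski sum of two capped sets is all of the expected capped set.\<close>

lemma nonneg_with_support_reutenauer_q:
  assumes "0 \<notin> set \<mu>"
  defines "p \<equiv> length (filter (\<lambda>n. n \<noteq> 1) \<mu>)"
  shows "2 * p \<le> sum_list \<mu> \<and>
    nonneg_with_support ((- 1) ^ p * reutenauer_q \<mu>) (capped (sum_list \<mu>) p)"
  using assms(1) unfolding p_def
proof (induction \<mu>)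
  case Nil
  have "nonneg_with_support 1 (capped 0 0)"
    by (auto simp: nonneg_with_support_def one_symfun.rep_eq capped_def mdeg_eq_0_iff)
  then show ?case by (simp add: reutenauer_q_def)
next
  case (Cons n \<mu>)
  define p where "p = length (filter (\<lambda>n. n \<noteq> 1) \<mu>)"
  define \<epsilon> :: nat where "\<epsilon> = (if n = 1 then 0 else 1)"
  define N where "N = sum_list \<mu>"
  have n: "n \<ge> 1" and p: "2 * p \<le> N"
    and \<mu>: "nonneg_with_support ((- 1) ^ p * reutenauer_q \<mu>) (capped N p)"
    using Cons by (auto simp: p_def N_def)
  have len: "length (filter (\<lambda>n. n \<noteq> 1) (n # \<mu>)) = \<epsilon> + p"
    by (simp add: \<epsilon>_def p_def)
  have prod: "(- 1) ^ (\<epsilon> + p) * reutenauer_q (n # \<mu>) =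
      ((- 1) ^ \<epsilon> * reutenauer_q_row n) * ((- 1) ^ p * reutenauer_q \<mu>)"
    by (simp add: reutenauer_q_def power_add)
  have "{\<alpha>. \<exists>\<beta>\<in>capped n \<epsilon>. \<exists>\<gamma>\<in>capped N p. \<alpha> = \<beta> + \<gamma>} = capped (n + N) (\<epsilon> + p)"
  proof (intro equalityI subsetI CollectI)
    fix \<alpha> assume \<alpha>: "\<alpha> \<in> capped (n + N) (\<epsilon> + p)"
    show "\<exists>\<beta>\<in>capped n \<epsilon>. \<exists>\<gamma>\<in>capped N p. \<alpha> = \<beta> + \<gamma>"
      using capped_0_split[of \<alpha> n N p] capped_1_split[of \<alpha> n N p] \<alpha> p n
      by (cases "n = 1") (simp_all add: \<epsilon>_def)
  qed (auto intro: capped_add)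
  then have "nonneg_with_support ((- 1) ^ (\<epsilon> + p) * reutenauer_q (n # \<mu>)) (capped (n + N) (\<epsilon> + p))"
    using nonneg_with_support_mult[OF nonneg_with_support_q_row[OF n, folded \<epsilon>_def] \<mu>]
    unfolding prod by (simp only:)
  moreover have "2 * (\<epsilon> + p) \<le> n + N"
    using n p by (auto simp: \<epsilon>_def)
  ultimately show ?case
    unfolding len by (simp add: N_def)
qed

section \<open>Saturation\<close>

lemma lookup_scaleR: "Poly_Mapping.lookup (r *\<^sub>R v) i = r * Poly_Mapping.lookup (v :: nat \<Rightarrow>\<^sub>0 real) i"
proof -
  have "finite {i. r * Poly_Mapping.lookup v i \<noteq> 0}"
    by (rule finite_subset[OF _ finite_keys[of v]]) (auto simp: in_keys_iff)
  then show ?thesis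
    by (simp add: scaleR_poly_mapping_def Abs_poly_mapping_inverse)
qed

text \<open>All conditions are linear. The degree of a real vector is expressed as the sum of its
  first \<open>m\<close> coordinates.\<close>

lemma convex_bounded_entries:
  "convex {v :: nat \<Rightarrow>\<^sub>0 real. (\<forall>i. 0 \<le> Poly_Mapping.lookup v i \<and> Poly_Mapping.lookup v i \<le> c)
     \<and> (\<forall>i\<ge>m. Poly_Mapping.lookup v i = 0) \<and> (\<Sum>i<m. Poly_Mapping.lookup v i) = s}"
proof (rule convexI, safe)
  fix v w :: "nat \<Rightarrow>\<^sub>0 real" and a b :: real and i
  assume ab: "0 \<le> a" "0 \<le> b" "a + b = 1"
    and v: "\<forall>i. 0 \<le> Poly_Mapping.lookup v i \<and> Poly_Mapping.lookup v i \<le> c"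
    and w: "\<forall>i. 0 \<le> Poly_Mapping.lookup w i \<and> Poly_Mapping.lookup w i \<le> c"
  show "0 \<le> Poly_Mapping.lookup (a *\<^sub>R v + b *\<^sub>R w) i"
    using ab v w by (simp add: lookup_add lookup_scaleR)
  show "Poly_Mapping.lookup (a *\<^sub>R v + b *\<^sub>R w) i \<le> c"
    using ab v w by (auto simp: lookup_add lookup_scaleR intro: convex_bound_le)
next
  fix v w :: "nat \<Rightarrow>\<^sub>0 real" and a b :: real
  assume ab: "a + b = 1"
    and eq: "(\<Sum>i<m. Poly_Mapping.lookup w i) = (\<Sum>i<m. Poly_Mapping.lookup v i)"
  have "(\<Sum>i<m. Poly_Mapping.lookup (a *\<^sub>R v + b *\<^sub>R w) i) = (a + b) * (\<Sum>i<m. Poly_Mapping.lookup v i)"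
    by (simp add: lookup_add lookup_scaleR sum.distrib sum_distrib_left[symmetric] eq distrib_right)
  then show "(\<Sum>i<m. Poly_Mapping.lookup (a *\<^sub>R v + b *\<^sub>R w) i) = (\<Sum>i<m. Poly_Mapping.lookup v i)"
    by (simp add: ab)
qed (simp_all add: lookup_add lookup_scaleR)

text \<open>The Newton polytope lies in a convex set whose lattice points are exactly the exponent
  vectors in the support.\<close>

lemma SNP_if_support_capped:
  assumes supp: "\<And>\<alpha>. Poly_Mapping.lookup g \<alpha> \<noteq> 0 \<longleftrightarrow> Poly_Mapping.keys \<alpha> \<subseteq> {..<m} \<and> \<alpha> \<in> capped N p"
  shows "SNP g"
  unfolding SNP_def
proof (intro ballI impI)
  fix v assume v: "v \<in> newton_polytope g" and int: "\<forall>i. Poly_Mapping.lookup v i \<in> \<int>"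
  \<comment> \<open>The bound is a difference of reals and thus agrees with the additive cap even
    when \<open>N < p\<close>.\<close>
  let ?C = "{v :: nat \<Rightarrow>\<^sub>0 real. (\<forall>i. 0 \<le> Poly_Mapping.lookup v i \<and> Poly_Mapping.lookup v i \<le> real N - real p)
     \<and> (\<forall>i\<ge>m. Poly_Mapping.lookup v i = 0) \<and> (\<Sum>i<m. Poly_Mapping.lookup v i) = real N}"
  have "real_expvec \<alpha> \<in> ?C" if "\<alpha> \<in> Poly_Mapping.keys g" for \<alpha>
  proof -
    have keys: "Poly_Mapping.keys \<alpha> \<subseteq> {..<m}" and \<alpha>: "\<alpha> \<in> capped N p"
      using that supp[of \<alpha>] by (auto simp: in_keys_iff)
    have "(\<Sum>i<m. Poly_Mapping.lookup \<alpha> i) = N"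
      using mdeg_superset[OF _ keys] \<alpha> by (simp add: capped_def)
    then have "(\<Sum>i<m. real (Poly_Mapping.lookup \<alpha> i)) = real N"
      by (metis of_nat_sum)
    moreover have "real (Poly_Mapping.lookup \<alpha> i) \<le> real N - real p" for i
    proof -
      have "Poly_Mapping.lookup \<alpha> i + p \<le> N" using \<alpha> by (simp add: capped_def)
      then show ?thesis by linarith
    qed
    moreover have "Poly_Mapping.lookup \<alpha> i = 0" if "i \<ge> m" for i
    proof -
      have "i \<notin> Poly_Mapping.keys \<alpha>" using that keys by auto
      then show ?thesis by (simp add: in_keys_iff)
    qed
    ultimately show ?thesis by (simp add: lookup_real_expvec)
  qed
  then have "newton_polytope g \<subseteq> ?C"
    unfolding newton_polytope_def by (intro hull_minimal convex_bounded_entries) blast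
  with v have vC: "v \<in> ?C" by blast
  \<comment> \<open>Rounding loses nothing, as the entries of \<open>v\<close> are nonnegative
    integers.\<close>
  define \<alpha> where "\<alpha> = Poly_Mapping.map (\<lambda>x. nat \<lfloor>x\<rfloor>) v"
  have \<alpha>: "real (Poly_Mapping.lookup \<alpha> i) = Poly_Mapping.lookup v i" for i
  proof -
    have "Poly_Mapping.lookup \<alpha> i = nat \<lfloor>Poly_Mapping.lookup v i\<rfloor>"
      by (simp add: \<alpha>_def map.rep_eq when_def)
    moreover have "0 \<le> Poly_Mapping.lookup v i" using vC by blast
    ultimately show ?thesis using int by (simp add: of_nat_nat)
  qed
  have "Poly_Mapping.lookup \<alpha> i = 0" if "i \<ge> m" for i
    using that vC \<alpha>[of i] by simp
  then have keys: "Poly_Mapping.keys \<alpha> \<subseteq> {..<m}"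
    by (metis in_keys_iff lessThan_iff not_less subsetI)
  have "real (mdeg \<alpha>) = (\<Sum>i<m. Poly_Mapping.lookup v i)"
    using mdeg_superset[OF _ keys] by (simp add: \<alpha>)
  then have "mdeg \<alpha> = N" using vC by simp
  moreover have "Poly_Mapping.lookup \<alpha> i + p \<le> N" for i
  proof -
    have "Poly_Mapping.lookup v i \<le> real N - real p" using vC by blast
    then show ?thesis using \<alpha>[of i] by linarith
  qed
  ultimately have "\<alpha> \<in> capped N p" by (simp add: capped_def)
  moreover have "v = real_expvec \<alpha>"
    by (rule poly_mapping_eqI) (simp add: lookup_real_expvec \<alpha>)
  ultimately show "\<exists>\<alpha>. v = real_expvec \<alpha> \<and> Poly_Mapping.lookup g \<alpha> \<noteq> 0"
    using keys supp by blast
qed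

theorem theorem2p32:
  fixes \<mu> :: "nat list"
  assumes "is_partition \<mu>"
  shows "sf_SNP (reutenauer_q \<mu>)"
proof -
  define p where "p = length (filter (\<lambda>n. n \<noteq> 1) \<mu>)"
  have *: "nonneg_with_support ((- 1) ^ p * reutenauer_q \<mu>) (capped (sum_list \<mu>) p)"
    using nonneg_with_support_reutenauer_q[of \<mu>] assms by (simp add: is_partition_def p_def)
  have "(- 1) ^ p * reutenauer_q \<mu> = reutenauer_q \<mu> \<or> (- 1) ^ p * reutenauer_q \<mu> = - reutenauer_q \<mu>"
    by (cases "even p") auto
  \<comment> \<open>A global sign does not affect the support.\<close>
  with * have "sf_coeff (reutenauer_q \<mu>) \<alpha> \<noteq> 0 \<longleftrightarrow> \<alpha> \<in> capped (sum_list \<mu>) p" for \<alpha>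
    by (metis nonneg_with_support_def uminus_symfun.rep_eq neg_equal_0_iff_equal)
  then have "SNP (sf_restrict m (reutenauer_q \<mu>))" for m
    by (intro SNP_if_support_capped[of _ m "sum_list \<mu>" p]) (simp add: sf_restrict.rep_eq)
  then show ?thesis by (simp add: sf_SNP_def)
qed

end
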